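(* Let $r\ge1$, let $$\mathbf p_{G_r}(\theta)=\hat b_{-1}e^{-\iota\theta}+\hat b_0+\hat b_1e^{\iota\theta}+\hat b_2e^{2\iota\theta}$$ be the $r\times r$ matrix-valued trigonometric polynomial (associated with the geometric projector for degree-$r$ Lagrangian finite elements) with coefficients given in the context, and let $\mathrm e_r=[1,\dots,1]^T\in\mathbb R^r$. Then: 1) $\mathbf p_{G_r}(0)\,\mathrm e_r=2\,\mathrm e_r$; 2) $\mathbf p_{G_r}(\pi)\,\mathrm e_r=0\,\mathrm e_r$; 3) $\mathbf p_{G_r}(0)$ is non-singular.
   Context: $\iota^2=-1$. Let $\phi_0^{2,r},\dots,\phi_{2r}^{2,r}$ be the Lagrangian basis of the space of continuous functions on $[0,1]$ whose restrictions to $[0,\frac12]$ and to $[\frac12,1]$ are polynomials of degree at most $r$, relative to the nodes $\frac{i}{2r}$, $i=0,\dots,2r$; that is, $\phi_j^{2,r}\left(\frac{i}{2r}\right)=\delta_{i,j}$. Let $\xi_i^{4,r}=\frac{i}{4r}$, $i=0,\dots,4r$. The coefficients $\hat b_{-1},\hat b_0,\hat b_1,\hat b_2\in\mathbb R^{r\times r}$ are, for $i,j=1,\dots,r$, $$[\hat b_{-1}]_{i,j}=\phi_j^{2,r}(\xi_i^{4,r}),\quad[\hat b_0]_{i,j}=\phi_j^{2,r}(\xi_{r+i}^{4,r}),\quad[\hat b_1]_{i,j}=\phi_j^{2,r}(\xi_{2r+i}^{4,r}),\quad[\hat b_2]_{i,j}=\phi_j^{2,r}(\xi_{3r+i}^{4,r}).$$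 (For $j<r$ the entries of $\hat b_1,\hat b_2$ vanish.) *)

theory Defs
  imports
    Complex_Main
    "HOL-Library.FuncSet"
    "HOL-Computational_Algebra.Polynomial"
    "Jordan_Normal_Form.Matrix"
begin

definition xi :: "nat \<Rightarrow> nat \<Rightarrow> nat \<Rightarrow> real"
  where "xi n r i = real i / (real n * real r)"

text \<open>A function on \<open>[0,1]\<close> is a total function that is \<^const>\<open>undefined\<close> elsewhere
  (\<^const>\<open>extensional\<close>), so that two of them are equal as soon as they agree on \<open>[0,1]\<close>.\<close>

definition fe_space :: "nat \<Rightarrow> (real \<Rightarrow> real) set"
  where "fe_space r = {f \<in> extensional {0..1}. continuous_on {0..1} f
    \<and> (\<exists>p. degree p \<le> r \<and> (\<forall>x\<in>{0..1/2}. f x = poly p x))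
    \<and> (\<exists>q. degree q \<le> r \<and> (\<forall>x\<in>{1/2..1}. f x = poly q x))}"

definition lagrange_fun :: "nat \<Rightarrow> nat \<Rightarrow> real \<Rightarrow> real"
  where "lagrange_fun r j =
    (THE f. f \<in> fe_space r \<and> (\<forall>i\<le>2*r. f (xi 2 r i) = (if i = j then 1 else 0)))"

lemma poly_interpolation_ex:
  fixes x c :: "nat \<Rightarrow> real"
  assumes "inj x"
  shows "\<exists>p. degree p \<le> n \<and> (\<forall>i\<le>n. poly p (x i) = c i)"
proof (induction n)
  case 0
  show ?case by (intro exI[of _ "[:c 0:]"]) auto
next
  case (Suc n)
  then obtain p where p: "degree p \<le> n" "\<And>i. i \<le> n \<Longrightarrow> poly p (x i) = c i" by blast
  define w where "w = (\<Prod>i\<le>n. [:- x i, 1:])"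
  define d where "d = (c (Suc n) - poly p (x (Suc n))) / poly w (x (Suc n))"
  have w0: "poly w (x i) = 0" if "i \<le> n" for i
    using that unfolding w_def poly_prod by (auto intro: prod_zero)
  have wn: "poly w (x (Suc n)) \<noteq> 0"
    using injD[OF assms, of "Suc n"] unfolding w_def poly_prod by (fastforce simp: prod_zero_iff)
  have dw: "degree w \<le> Suc n"
    unfolding w_def by (rule order_trans[OF degree_prod_sum_le]) auto
  show ?case
  proof (intro exI[of _ "p + Polynomial.smult d w"] conjI allI impI)
    show "degree (p + Polynomial.smult d w) \<le> Suc n"
      using p(1) dw by (intro degree_add_le order_trans[OF degree_smult_le]) auto
    show "poly (p + Polynomial.smult d w) (x i) = c i" if "i \<le> Suc n" for i
      using that p(2) w0 wn by (cases "i = Suc n") (auto simp: d_def)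
  qed
qed

lemma poly_eq_of_nodes:
  fixes x :: "nat \<Rightarrow> real" and p q :: "real poly"
  assumes "inj x" "degree p \<le> n" "degree q \<le> n" "\<And>i. i \<le> n \<Longrightarrow> poly p (x i) = poly q (x i)"
  shows "p = q"
proof (rule ccontr)
  assume "p \<noteq> q"
  hence ne: "p - q \<noteq> 0" by simp
  have "Suc n = card (x ` {..n})"
    using assms(1) by (simp add: card_image inj_on_def inj_def)
  also have "\<dots> \<le> card {t. poly (p - q) t = 0}"
    using assms(4) ne by (intro card_mono poly_roots_finite) auto
  also have "\<dots> \<le> degree (p - q)" using ne by (rule card_poly_roots_bound)
  also have "\<dots> \<le> n" using assms(2,3) by (rule degree_diff_le)
  finally show False by simp
qed

text \<open>Nodal values determine a unique element of the space; hence \<^const>\<open>lagrange_fun\<close> is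
  well defined and the functions \<open>lagrange_fun r 0, \<dots>, lagrange_fun r (2*r)\<close> are a basis.\<close>

lemma fe_space_nodal_ex1:
  assumes "1 \<le> r"
  shows "\<exists>!f. f \<in> fe_space r \<and> (\<forall>i\<le>2*r. f (xi 2 r i) = c i)"
proof -
  have injL: "inj (xi 2 r)"
    using assms by (auto simp: inj_def xi_def)
  have injR: "inj (\<lambda>i. xi 2 r (r + i))"
    using assms by (auto simp: inj_def xi_def)
  have mid: "xi 2 r r = 1/2"
    using assms by (auto simp: xi_def field_simps)
  have L: "xi 2 r i \<in> {0..1/2}" if "i \<le> r" for i
    using that assms by (auto simp: xi_def field_simps)
  have R: "xi 2 r (r + i) \<in> {1/2..1}" if "i \<le> r" for i
    using that assms by (auto simp: xi_def field_simps)
  obtain p where p: "degree p \<le> r" "\<And>i. i \<le> r \<Longrightarrow> poly p (xi 2 r i) = c i"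
    using poly_interpolation_ex[OF injL, of r c] by blast
  obtain q where q: "degree q \<le> r" "\<And>i. i \<le> r \<Longrightarrow> poly q (xi 2 r (r + i)) = c (r + i)"
    using poly_interpolation_ex[OF injR, of r "\<lambda>i. c (r + i)"] by blast
  have pq: "poly p (1/2) = poly q (1/2)"
    using p(2)[of r] q(2)[of 0] mid by simp
  define g where "g = restrict (\<lambda>x. if x \<le> 1/2 then poly p x else poly q x) {0..1}"
  have gL: "g x = poly p x" if "x \<in> {0..1/2}" for x
    using that by (auto simp: g_def)
  have gR: "g x = poly q x" if "x \<in> {1/2..1}" for x
  proof (cases "x = 1/2")
    case True
    show ?thesis unfolding True using pq by (simp add: g_def)
  next
    case False
    then show ?thesis using that by (auto simp: g_def)
  qed
  have split: "{0..1/2} \<union> {1/2..1} = {0..1::real}" by auto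
  have "continuous_on ({0..1/2} \<union> {1/2..1}) g"
  proof (rule continuous_on_closed_Un)
    show "continuous_on {0..1/2} g"
      using gL by (subst continuous_on_cong[OF refl, of _ _ "poly p"]) (auto intro: continuous_intros)
    show "continuous_on {1/2..1} g"
      using gR by (subst continuous_on_cong[OF refl, of _ _ "poly q"]) (auto intro: continuous_intros)
  qed auto
  hence cont: "continuous_on {0..1} g" by (simp only: split)
  have g: "g \<in> fe_space r"
    unfolding fe_space_def using cont gL gR p(1) q(1) by (auto simp: g_def)
  have split_nodes: "i \<le> r \<or> (\<exists>k\<le>r. i = r + k)" if "i \<le> 2*r" for i
    using that by (cases "i \<le> r") (auto intro!: exI[of _ "i - r"])
  show ?thesis
  proof (rule ex1I[of _ g])
    show "g \<in> fe_space r \<and> (\<forall>i\<le>2*r. g (xi 2 r i) = c i)"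
      using g split_nodes gL[OF L] gR[OF R] p(2) q(2) by metis
    fix f assume f: "f \<in> fe_space r \<and> (\<forall>i\<le>2*r. f (xi 2 r i) = c i)"
    then obtain p' q' where p': "degree p' \<le> r" "\<And>x. x \<in> {0..1/2} \<Longrightarrow> f x = poly p' x"
      and q': "degree q' \<le> r" "\<And>x. x \<in> {1/2..1} \<Longrightarrow> f x = poly q' x"
      and ext: "f \<in> extensional {0..1}"
      unfolding fe_space_def by blast
    have "p' = p"
    proof (rule poly_eq_of_nodes[OF injL p'(1) p(1)])
      show "poly p' (xi 2 r i) = poly p (xi 2 r i)" if "i \<le> r" for i
        using that f p'(2)[OF L[OF that]] p(2)[OF that] by auto
    qed
    moreover have "q' = q"
    proof (rule poly_eq_of_nodes[OF injR q'(1) q(1)])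
      show "poly q' (xi 2 r (r + i)) = poly q (xi 2 r (r + i))" if "i \<le> r" for i
        using that f q'(2)[OF R[OF that]] q(2)[OF that] by auto
    qed
    ultimately have "f x = g x" if "x \<in> {0..1}" for x
      using that p'(2) q'(2) gL gR by (cases "x \<le> 1/2") auto
    thus "f = g"
      using ext by (intro extensionalityI[of _ "{0..1}"]) (auto simp: g_def)
  qed
qed

text \<open>Matrix indices start at \<open>0\<close>, so the entry in position \<open>(i, j)\<close> uses row \<open>i + 1\<close> and
  column \<open>j + 1\<close>. The index \<open>k\<close> ranges over \<open>-1, 0, 1, 2\<close>.\<close>

definition bhat :: "nat \<Rightarrow> int \<Rightarrow> real mat"
  where "bhat r k = mat r r
    (\<lambda>(i, j). lagrange_fun r (j + 1) (xi 4 r (nat (k + 1) * r + (i + 1))))"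

definition p_G :: "nat \<Rightarrow> real \<Rightarrow> complex mat"
  where "p_G r \<theta> =
      exp (- \<i> * complex_of_real \<theta>) \<cdot>\<^sub>m map_mat complex_of_real (bhat r (-1))
    + map_mat complex_of_real (bhat r 0)
    + exp (\<i> * complex_of_real \<theta>) \<cdot>\<^sub>m map_mat complex_of_real (bhat r 1)
    + exp (2 * \<i> * complex_of_real \<theta>) \<cdot>\<^sub>m map_mat complex_of_real (bhat r 2)"

definition ones_vec :: "nat \<Rightarrow> complex vec"
  where "ones_vec r = vec r (\<lambda>_. 1)"

end

theory Submission
  imports Defs "Jordan_Normal_Form.Determinant"
begin

text \<open>After rescaling both halves of \<open>[0,1]\<close> to the whole interval, every entry of the
  coefficients is a value of a degree-\<open>r\<close> Lagrange basis polynomial \<open>l\<^sub>j\<close> at some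
  \<open>t = i/(2r)\<close> or \<open>t + 1/2\<close>. As the \<open>l\<^sub>j\<close> sum to \<open>1\<close>, the rows of the four coefficients sum to
  \<open>1 - l\<^sub>0(t)\<close>, \<open>1 - l\<^sub>0(t + 1/2)\<close>, \<open>l\<^sub>0(t)\<close> and \<open>l\<^sub>0(t + 1/2)\<close>, which gives the first two claims.
  For the third, a kernel vector \<open>v\<close> of the symbol at \<open>0\<close> is the vector of nodal values of a
  polynomial \<open>q\<close> of degree at most \<open>r\<close> with \<open>q(0) = q(1)\<close> and \<open>q(t) + q(t + 1/2) = 0\<close> for
  \<open>t = i/(2r)\<close>, \<open>i = 1, \<dots>, r\<close>. Periodicity extends this to \<open>i = 0\<close>, so \<open>q(x) + q(x + 1/2)\<close> has
  \<open>r + 1\<close> zeros and vanishes; comparing leading coefficients, \<open>q = 0\<close>.\<close>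

lemma invertible_mat_of_det_nonzero:
  fixes A :: "'a :: field mat"
  assumes A: "A \<in> carrier_mat n n" and "det A \<noteq> 0"
  shows "invertible_mat A"
proof -
  have "A \<in> Units (ring_mat TYPE('a) n ())"
    using assms by (rule det_non_zero_imp_unit)
  then obtain C where "C \<in> carrier_mat n n" "C * A = 1\<^sub>m n" "A * C = 1\<^sub>m n"
    by (auto simp: Units_def ring_mat_simps)
  thus ?thesis using A by (auto simp: invertible_mat_def inverts_mat_def)
qed

text \<open>A shift keeps the leading coefficient, so here that coefficient equals its own negative
  and vanishes in characteristic 0.\<close>

lemma poly_antiperiodic_eq_0:
  fixes q :: "'a :: {idom, ring_char_0} poly"
  assumes "q + q \<circ>\<^sub>p [:c, 1:] = 0"
  shows "q = 0"
proof -
  have "lead_coeff (q \<circ>\<^sub>p [:c, 1:]) = lead_coeff q"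
    by (subst lead_coeff_comp) auto
  moreover have "q \<circ>\<^sub>p [:c, 1:] = - q" using assms by (simp add: eq_neg_iff_add_eq_0 add.commute)
  ultimately show ?thesis by simp
qed

lemma inj_equispaced: "1 \<le> r \<Longrightarrow> inj (\<lambda>i. real i / real r)"
  by (auto simp: inj_def)

text \<open>The Lagrange basis on all of [0,1], to which both halves rescale. For
  \<open>j > r\<close> every prescribed value is 0, so the polynomial is zero; this lets one formula
  cover all basis functions on the left half.\<close>

definition nodal_poly :: "nat \<Rightarrow> nat \<Rightarrow> real poly"
  where "nodal_poly r j = (SOME p. degree p \<le> r \<and>
    (\<forall>i\<le>r. poly p (real i / real r) = (if i = j then 1 else 0)))"

context
  fixes r :: nat
  assumes r: "1 \<le> r"
begin

lemma nodal_poly_ex: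
  "degree (nodal_poly r j) \<le> r \<and>
    (\<forall>i\<le>r. poly (nodal_poly r j) (real i / real r) = (if i = j then 1 else 0))"
  unfolding nodal_poly_def
  by (rule someI_ex[OF poly_interpolation_ex[OF inj_equispaced[OF r]]])

lemma degree_nodal_poly: "degree (nodal_poly r j) \<le> r"
  using nodal_poly_ex by blast

lemma poly_nodal_poly:
  "i \<le> r \<Longrightarrow> poly (nodal_poly r j) (real i / real r) = (if i = j then 1 else 0)"
  using nodal_poly_ex by blast

lemma sum_nodal_poly: "(\<Sum>j\<le>r. poly (nodal_poly r j) x) = 1"
proof -
  have "(\<Sum>j\<le>r. nodal_poly r j) = 1"
  proof (rule poly_eq_of_nodes[OF inj_equispaced[OF r]])
    show "degree (\<Sum>j\<le>r. nodal_poly r j) \<le> r"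
      by (intro degree_sum_le) (auto intro: degree_nodal_poly)
  qed (auto simp: poly_sum poly_nodal_poly)
  hence "poly (\<Sum>j\<le>r. nodal_poly r j) x = 1" by simp
  thus ?thesis by (simp add: poly_sum)
qed

lemma sum_nodal_poly_Suc:
  "(\<Sum>j<r. poly (nodal_poly r (Suc j)) x) = 1 - poly (nodal_poly r 0) x"
proof -
  have "(\<Sum>j\<le>r. poly (nodal_poly r j) x)
      = poly (nodal_poly r 0) x + (\<Sum>j<r. poly (nodal_poly r (Suc j)) x)"
    by (rule sum.atMost_shift)
  thus ?thesis using sum_nodal_poly[of x] by simp
qed

text \<open>On each half the polynomial piece is fixed by the \<open>r + 1\<close> nodes there,
  which rescale to \<open>i / r\<close>. The midpoint is a node of both halves, so only
  \<open>j = r\<close> is nonzero on both.\<close>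

lemma lagrange_fun_nodal:
  assumes j: "j \<le> 2 * r"
  shows "x \<in> {0..1/2} \<Longrightarrow> lagrange_fun r j x = poly (nodal_poly r j) (2 * x)"
    and "x \<in> {1/2..1} \<Longrightarrow>
      lagrange_fun r j x = (if r \<le> j then poly (nodal_poly r (j - r)) (2 * x - 1) else 0)"
proof -
  let ?f = "lagrange_fun r j"
  have f: "?f \<in> fe_space r" and nod: "\<And>i. i \<le> 2 * r \<Longrightarrow> ?f (xi 2 r i) = (if i = j then 1 else 0)"
    using theI'[OF fe_space_nodal_ex1[OF r, of "\<lambda>i. if i = j then 1 else 0"]]
    unfolding lagrange_fun_def by blast+
  obtain p q where p: "degree p \<le> r" "\<And>x. x \<in> {0..1/2} \<Longrightarrow> ?f x = poly p x"
    and q: "degree q \<le> r" "\<And>x. x \<in> {1/2..1} \<Longrightarrow> ?f x = poly q x"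
    using f unfolding fe_space_def by blast
  have deg: "degree (u \<circ>\<^sub>p [:c, 2:]) \<le> r" if "degree u \<le> r" for u :: "real poly" and c
    using that by (simp add: degree_pcompose)
  have "p = nodal_poly r j \<circ>\<^sub>p [:0, 2:]"
  proof (rule poly_eq_of_nodes)
    show "inj (xi 2 r)" using r by (auto simp: inj_def xi_def)
    show "poly p (xi 2 r i) = poly (nodal_poly r j \<circ>\<^sub>p [:0, 2:]) (xi 2 r i)" if "i \<le> r" for i
    proof -
      have "xi 2 r i \<in> {0..1/2}" "xi 2 r i * 2 = real i / real r"
        using r that by (auto simp: xi_def field_simps)
      thus ?thesis using p(2)[of "xi 2 r i"] nod[of i] that by (simp add: poly_pcompose poly_nodal_poly)
    qed
  qed (use p deg degree_nodal_poly in auto)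
  thus "?f x = poly (nodal_poly r j) (2 * x)" if "x \<in> {0..1/2}" for x
    using p(2)[OF that] by (simp add: poly_pcompose mult.commute)
  have "q = (if r \<le> j then nodal_poly r (j - r) \<circ>\<^sub>p [:-1, 2:] else 0)"
  proof (rule poly_eq_of_nodes)
    show "inj (\<lambda>i. xi 2 r (r + i))" using r by (auto simp: inj_def xi_def)
    show "poly q (xi 2 r (r + i)) =
        poly (if r \<le> j then nodal_poly r (j - r) \<circ>\<^sub>p [:-1, 2:] else 0) (xi 2 r (r + i))"
      if "i \<le> r" for i
    proof -
      have "xi 2 r (r + i) \<in> {1/2..1}" "xi 2 r (r + i) * 2 - 1 = real i / real r"
        using r that by (auto simp: xi_def field_simps)
      thus ?thesis using q(2)[of "xi 2 r (r + i)"] nod[of "r + i"] that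
        by (cases "r + i = j") (auto simp: poly_pcompose poly_nodal_poly)
    qed
  qed (use q deg degree_nodal_poly in auto)
  thus "?f x = (if r \<le> j then poly (nodal_poly r (j - r)) (2 * x - 1) else 0)"
    if "x \<in> {1/2..1}" for x
    using q(2)[OF that] by (simp add: poly_pcompose mult.commute)
qed

text \<open>As \<open>t\<close> is at most 1/2, the sample points \<open>t / 2\<close> and
  \<open>(t + 1/2) / 2\<close> lie in the left half, \<open>(t + 1) / 2\<close> and
  \<open>(t + 3/2) / 2\<close> in the right one. Of the basis functions 1 to \<open>r\<close>, only
  that of the midpoint, in the last column, is nonzero on the right.\<close>

lemma bhat_entries:
  assumes ij: "i < r" "j < r"
  defines "t \<equiv> real (Suc i) / (2 * real r)"
  shows "bhat r (-1) $$ (i, j) = poly (nodal_poly r (Suc j)) t"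
    and "bhat r 0 $$ (i, j) = poly (nodal_poly r (Suc j)) (t + 1/2)"
    and "bhat r 1 $$ (i, j) = (if Suc j = r then poly (nodal_poly r 0) t else 0)"
    and "bhat r 2 $$ (i, j) = (if Suc j = r then poly (nodal_poly r 0) (t + 1/2) else 0)"
proof -
  have t: "0 \<le> t" "t \<le> 1/2" using ij unfolding t_def by (auto simp: field_simps)
  have x: "xi 4 r (k * r + (i + 1)) = (t + k / 2) / 2" for k
    using r unfolding t_def xi_def by (simp add: field_simps)
  have b: "bhat r k $$ (i, j) = lagrange_fun r (Suc j) ((t + nat (k + 1) / 2) / 2)" for k
    unfolding x[symmetric] using ij by (simp add: bhat_def)
  have half: "(2 * t + 1) / 2 = t + 1/2" "(2 * t + 2) / 2 - 1 = t" "(2 * t + 3) / 2 - 1 = t + 1/2"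
    by (simp_all add: field_simps)
  note L = lagrange_fun_nodal(1)[of "Suc j"] and R = lagrange_fun_nodal(2)[of "Suc j"]
  have j: "Suc j \<le> 2 * r" "r \<le> Suc j \<longleftrightarrow> Suc j = r" using ij by auto
  show "bhat r (-1) $$ (i, j) = poly (nodal_poly r (Suc j)) t"
    using t j by (simp add: b L)
  show "bhat r 0 $$ (i, j) = poly (nodal_poly r (Suc j)) (t + 1/2)"
    using t j by (simp add: b L half)
  show "bhat r 1 $$ (i, j) = (if Suc j = r then poly (nodal_poly r 0) t else 0)"
    using t j by (simp add: b R half)
  show "bhat r 2 $$ (i, j) = (if Suc j = r then poly (nodal_poly r 0) (t + 1/2) else 0)"
    using t j by (simp add: b R half)
qed

lemma bhat_carrier: "bhat r k \<in> carrier_mat r r"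
  by (simp add: bhat_def)

lemma sum_last: "(\<Sum>j<r. if Suc j = r then f j else 0) = (f (r - 1) :: real)"
proof -
  have "(\<Sum>j<r. if Suc j = r then f j else 0) = (\<Sum>j<r. if j = r - 1 then f j else 0)"
    using r by (intro sum.cong) auto
  thus ?thesis using r by simp
qed

text \<open>The columns of the first two blocks omit the basis polynomial of node 0, the one term
  missing from the partition of unity; the last two blocks contain just this term.\<close>

lemma bhat_row_sums:
  assumes i: "i < r"
  defines "u \<equiv> poly (nodal_poly r 0) (real (Suc i) / (2 * real r))"
    and "v \<equiv> poly (nodal_poly r 0) (real (Suc i) / (2 * real r) + 1/2)"
  shows "(\<Sum>j<r. bhat r (-1) $$ (i, j)) = 1 - u" "(\<Sum>j<r. bhat r 0 $$ (i, j)) = 1 - v"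
    "(\<Sum>j<r. bhat r 1 $$ (i, j)) = u" "(\<Sum>j<r. bhat r 2 $$ (i, j)) = v"
  using i by (simp_all add: bhat_entries sum_nodal_poly_Suc sum_last u_def v_def del: of_nat_Suc)

lemma p_G_mult_ones:
  assumes i: "i < r"
  shows "(p_G r \<theta> *\<^sub>v ones_vec r) $ i =
      exp (- \<i> * of_real \<theta>) * of_real (\<Sum>j<r. bhat r (-1) $$ (i, j))
    + of_real (\<Sum>j<r. bhat r 0 $$ (i, j))
    + exp (\<i> * of_real \<theta>) * of_real (\<Sum>j<r. bhat r 1 $$ (i, j))
    + exp (2 * \<i> * of_real \<theta>) * of_real (\<Sum>j<r. bhat r 2 $$ (i, j))"
  using i bhat_carrier
  by (simp add: p_G_def ones_vec_def scalar_prod_def atLeast0LessThan sum.distrib sum_distrib_left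
      bhat_def)

lemma bhat_sum_kernel:
  fixes v :: "real vec"
  assumes v: "v \<in> carrier_vec r"
    and zero: "(bhat r (-1) + bhat r 0 + bhat r 1 + bhat r 2) *\<^sub>v v = 0\<^sub>v r"
  shows "v = 0\<^sub>v r"
proof -
  \<comment> \<open>Entry \<open>j\<close> of \<open>v\<close> is the value at node
    \<open>j + 1\<close>. The last entry is used again at node 0, because the last column carries
    the basis polynomial of node 0 in the blocks 1 and 2; hence \<open>q\<close> takes equal values
    at 0 and 1.\<close>
  define q where "q = (\<Sum>j<r. Polynomial.smult (v $ j) (nodal_poly r (Suc j)))
    + Polynomial.smult (v $ (r - 1)) (nodal_poly r 0)"
  have deg: "degree q \<le> r" unfolding q_def
    by (intro degree_add_le degree_sum_le order_trans[OF degree_smult_le] degree_nodal_poly) auto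
  have q: "poly q x = (\<Sum>j<r. v $ j * poly (nodal_poly r (Suc j)) x)
      + v $ (r - 1) * poly (nodal_poly r 0) x" for x
    by (simp add: q_def poly_sum)
  have q0: "poly q 0 = v $ (r - 1)"
    using poly_nodal_poly[of 0] by (simp add: q)
  have qn: "poly q (real (Suc i) / real r) = v $ i" if "i < r" for i
  proof -
    have "(\<Sum>j<r. v $ j * poly (nodal_poly r (Suc j)) (real (Suc i) / real r))
        = (\<Sum>j<r. if i = j then v $ j else 0)"
      using that poly_nodal_poly[of "Suc i"] by (intro sum.cong) auto
    thus ?thesis using that poly_nodal_poly[of "Suc i" 0] by (simp add: q del: of_nat_Suc)
  qed
  have q1: "poly q 1 = v $ (r - 1)" using qn[of "r - 1"] r by simp
  let ?g = "q + q \<circ>\<^sub>p [:1/2, 1:]"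
  have g: "poly ?g x = poly q x + poly q (x + 1/2)" for x
    by (simp add: poly_pcompose add.commute)
  have gz: "poly ?g (real (Suc i) / (2 * real r)) = 0" if i: "i < r" for i
  proof -
    let ?t = "real (Suc i) / (2 * real r)"
    have "0 = ((bhat r (-1) + bhat r 0 + bhat r 1 + bhat r 2) *\<^sub>v v) $ i"
      using i by (simp add: zero)
    also have "\<dots> = (\<Sum>j<r. (bhat r (-1) + bhat r 0 + bhat r 1 + bhat r 2) $$ (i, j) * v $ j)"
      using i v by (simp add: scalar_prod_def atLeast0LessThan carrier_matD[OF bhat_carrier])
    also have "\<dots> = (\<Sum>j<r. v $ j * poly (nodal_poly r (Suc j)) ?t
        + v $ j * poly (nodal_poly r (Suc j)) (?t + 1/2)
        + (if Suc j = r then v $ j * (poly (nodal_poly r 0) ?t + poly (nodal_poly r 0) (?t + 1/2))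
           else 0))"
      using i bhat_carrier
      by (intro sum.cong) (auto simp: bhat_entries carrier_matD[OF bhat_carrier] algebra_simps
          simp del: of_nat_Suc)
    also have "\<dots> = poly ?g ?t"
      unfolding g q sum.distrib sum_last by (simp add: algebra_simps)
    finally show ?thesis by simp
  qed
  have "?g = 0"
  proof (rule poly_eq_of_nodes)
    show "inj (\<lambda>i. real i / (2 * real r))" using r by (auto simp: inj_def)
    show "degree ?g \<le> r" using deg by (intro degree_add_le) (auto simp: degree_pcompose)
    show "poly ?g (real i / (2 * real r)) = poly 0 (real i / (2 * real r))" if "i \<le> r" for i
    proof (cases i)
      case 0
      \<comment> \<open>The last row, where \<open>t = 1/2\<close>, supplies the zero at 0 once the
        value at 1 is replaced by the equal value at 0.\<close>
      have "poly q (1/2) + poly q 1 = 0"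
        using gz[of "r - 1"] r unfolding g by simp
      thus ?thesis unfolding g using 0 q0 q1 by simp
    next
      case (Suc k)
      thus ?thesis using gz[of k] that by simp
    qed
  qed auto
  hence "q = 0" by (rule poly_antiperiodic_eq_0)
  thus ?thesis using qn v by (intro eq_vecI) auto
qed

text \<open>All exponentials are 1 at angle 0, so the symbol is a real matrix embedded in the
  complex ones. The determinant commutes with the embedding, hence a trivial real kernel
  suffices.\<close>

lemma invertible_p_G_0: "invertible_mat (p_G r 0)"
proof -
  define B where "B = bhat r (-1) + bhat r 0 + bhat r 1 + bhat r 2"
  have B: "B \<in> carrier_mat r r" using bhat_carrier by (simp add: B_def)
  interpret h: comm_ring_hom complex_of_real by unfold_locales auto
  have p: "p_G r 0 = map_mat complex_of_real B"
    using bhat_carrier by (intro eq_matI) (auto simp: p_G_def B_def bhat_def)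
  have "det B \<noteq> 0"
    using det_0_iff_vec_prod_zero[OF B] bhat_sum_kernel unfolding B_def by blast
  hence "det (p_G r 0) \<noteq> 0" unfolding p by simp
  moreover have "p_G r 0 \<in> carrier_mat r r" using B by (simp add: p)
  ultimately show ?thesis by (intro invertible_mat_of_det_nonzero)
qed

end

theorem lemma5p3:
  fixes r :: nat
  assumes "1 \<le> r"
  shows "p_G r 0 *\<^sub>v ones_vec r = 2 \<cdot>\<^sub>v ones_vec r
    \<and> p_G r pi *\<^sub>v ones_vec r = 0 \<cdot>\<^sub>v ones_vec r
    \<and> invertible_mat (p_G r 0)"
proof (intro conjI)
  have dim: "dim_row (p_G r \<theta>) = r" "dim_vec (p_G r \<theta> *\<^sub>v ones_vec r) = r" "dim_vec (ones_vec r) = r" for \<theta>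
    by (simp_all add: p_G_def bhat_def ones_vec_def)
  \<comment> \<open>With \<open>u\<close>, \<open>v\<close> as in \<open>bhat_row_sums\<close>,
    these signs turn each row sum into \<open>-(1 - u) + (1 - v) - u + v = 0\<close>.\<close>
  have e: "exp (- \<i> * complex_of_real pi) = -1" "exp (\<i> * complex_of_real pi) = -1"
    "exp (2 * \<i> * complex_of_real pi) = 1"
    by (simp_all add: exp_minus mult_ac)
  show "p_G r 0 *\<^sub>v ones_vec r = 2 \<cdot>\<^sub>v ones_vec r"
  proof (rule eq_vecI)
    fix i assume "i < dim_vec (2 \<cdot>\<^sub>v ones_vec r)"
    hence "i < r" by (simp add: dim)
    thus "(p_G r 0 *\<^sub>v ones_vec r) $ i = (2 \<cdot>\<^sub>v ones_vec r) $ i"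
      by (simp only: p_G_mult_ones[OF assms] bhat_row_sums[OF assms]) (simp add: ones_vec_def)
  qed (simp add: dim)
  show "p_G r pi *\<^sub>v ones_vec r = 0 \<cdot>\<^sub>v ones_vec r"
  proof (rule eq_vecI)
    fix i assume "i < dim_vec (0 \<cdot>\<^sub>v ones_vec r)"
    hence "i < r" by (simp add: dim)
    thus "(p_G r pi *\<^sub>v ones_vec r) $ i = (0 \<cdot>\<^sub>v ones_vec r) $ i"
      by (simp only: p_G_mult_ones[OF assms] bhat_row_sums[OF assms] e) (simp add: ones_vec_def)
  qed (simp add: dim)
  show "invertible_mat (p_G r 0)" by (rule invertible_p_G_0[OF assms])
qed

end
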